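(* Let $(X,O)$ be a germ of a normal surface singularity with minimal resolution $\pi:\tilde X\to X$, exceptional components $E_1,\dots,E_n$ and dual graph $\Gamma$, and suppose that $(NN)$ is true for $(X,O)$. Then: (1) $(NN)$ is true for any subgraph of $\Gamma$: for every subset $I\subset\{1,\dots,n\}$ and all $i,j\in I$ with $i\ne j$ there exist positive integers $(n_k)_{k\in I}$ with $n_i<n_j$ and $\left(\sum_{l\in I}n_lE_l\right)\cdot E_k\le -2K_{\tilde X}\cdot E_k$ for all $k\in I$. (2) $(NN)$ remains true when the self-intersection numbers are decreased: if $(X',O')$ is a germ of a normal surface singularity whose minimal resolution has exceptional components $E_1',\dots,E_n'$ with $p(E_i')=p(E_i)$ for all $i$, $E_i'\cdot E_j'=E_i\cdot E_j$ for all $i\neq j$, and $E_i'\cdot E_i'\le E_i\cdot E_i$ for all $i$, then $(NN)$ is true for $(X',O')$.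
   Context: Setting: $(X,O)$ is a germ of a normal surface singularity (over $\mathbb C$), $\pi:\tilde X\to X$ is its minimal resolution of singularities, $E_1,\dots,E_n$ are the irreducible components of the exceptional divisor, and $K_{\tilde X}$ is the canonical divisor of $\tilde X$. The intersection matrix $A=(a_{i,j})$, $a_{i,j}=E_i\cdot E_j$, is symmetric, negative definite, with integer entries and $a_{i,j}\ge 0$ for $i\ne j$. The dual graph $\Gamma$ has vertices $E_1,\dots,E_n$ and an edge between $E_i$ and $E_j$ ($i\neq j$) if and only if $a_{i,j}\ne0$; it is connected. Subgraphs in the proposition are the full subgraphs spanned by a set of vertices. The (arithmetic) genus $p(E_i)$ is given by adjunction: $p(E_i)=\frac{E_i\cdot(E_i+K_{\tilde X})}{2}+1$, so $K_{\tilde X}\cdot E_i=2(p(E_i)-1)-E_i^2$, and $K_{\tilde X}\cdot E_i\ge0$ for all $i$ because the resolution is minimal. For $i\ne j$, $(NN_{(i,j)})$ is the condition: there exist positive integers $n_1,\dots,n_n$ with $n_i<n_j$ such that $E=\sum_{k=1}^n n_kE_k$ satisfies $E\cdot E_k\le -2K_{\tilde X}\cdot E_k$ for all $k=1,\dots,n$. Condition $(NN)$ means that $(NN_{(i,j)})$ holds for all ordered pairs $(i,j)$ with $i\neq j$. *)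

theory Defs
  imports Complex_Main
begin

text \<open>
  Complex surface germs and their resolutions are not available in the libraries, so a
  minimal resolution of a normal surface singularity enters through its numerical
  data: the number of exceptional components \<open>E\<^sub>1, \<dots>, E\<^sub>n\<close>, the intersection numbers
  \<open>E\<^sub>i \<cdot> E\<^sub>j\<close> (field \<open>isect\<close>) and the numbers \<open>K \<cdot> E\<^sub>i\<close> for the canonical divisor \<open>K\<close>
  of the resolution (field \<open>canon\<close>). Values at indices outside \<open>{1..n}\<close> are irrelevant.
\<close>

record resolution =
  ncomp :: nat
  isect :: "nat \<Rightarrow> nat \<Rightarrow> int"
  canon :: "nat \<Rightarrow> int"

definition comps :: "resolution \<Rightarrow> nat set" where
  "comps X = {1..ncomp X}"

text \<open>Arithmetic genus by adjunction; the parity assumption in \<open>minimal_resolution\<close> below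
  makes the division exact.\<close>

definition genus :: "resolution \<Rightarrow> nat \<Rightarrow> int" where
  "genus X i = (isect X i i + canon X i) div 2 + 1"

definition dual_graph :: "resolution \<Rightarrow> (nat \<times> nat) set" where
  "dual_graph X = {(i, j). i \<in> comps X \<and> j \<in> comps X \<and> i \<noteq> j \<and> isect X i j \<noteq> 0}"

text \<open>
  The last conjunct is minimality: there is no \<open>(-1)\<close>-curve, an irreducible curve of arithmetic
  genus \<open>0\<close> being smooth and rational. By \<open>minimal_resolution_canon_nonneg\<close> it yields
  \<open>K \<cdot> E\<^sub>i \<ge> 0\<close>.
\<close>

definition minimal_resolution :: "resolution \<Rightarrow> bool" where
  "minimal_resolution X \<longleftrightarrow>
     1 \<le> ncomp X \<and>
     (\<forall>i\<in>comps X. \<forall>j\<in>comps X. isect X i j = isect X j i) \<and>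
     (\<forall>i\<in>comps X. \<forall>j\<in>comps X. i \<noteq> j \<longrightarrow> 0 \<le> isect X i j) \<and>
     (\<forall>x :: nat \<Rightarrow> real. (\<exists>i\<in>comps X. x i \<noteq> 0) \<longrightarrow>
        (\<Sum>i\<in>comps X. \<Sum>j\<in>comps X. x i * x j * of_int (isect X i j)) < 0) \<and>
     (\<forall>i\<in>comps X. \<forall>j\<in>comps X. (i, j) \<in> (dual_graph X)\<^sup>*) \<and>
     (\<forall>i\<in>comps X. even (isect X i i + canon X i)) \<and>
     (\<forall>i\<in>comps X. 0 \<le> genus X i) \<and>
     (\<forall>i\<in>comps X. \<not> (genus X i = 0 \<and> isect X i i = - 1))"

text \<open>\<open>cycle_dot X S m k\<close> is the intersection number \<open>(\<Sum>l\<in>S. m\<^sub>l E\<^sub>l) \<cdot> E\<^sub>k\<close>.\<close>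

definition cycle_dot :: "resolution \<Rightarrow> nat set \<Rightarrow> (nat \<Rightarrow> int) \<Rightarrow> nat \<Rightarrow> int" where
  "cycle_dot X S m k = (\<Sum>l\<in>S. m l * isect X l k)"

text \<open>For \<open>S = comps X\<close> these are the conditions \<open>(NN\<^sub>i\<^sub>j)\<close> and \<open>(NN)\<close>; in general, for the full subgraph spanned
  by the vertex set \<open>S\<close>, where the canonical numbers are those of the ambient resolution.\<close>

definition NN_pair_on :: "resolution \<Rightarrow> nat set \<Rightarrow> nat \<Rightarrow> nat \<Rightarrow> bool" where
  "NN_pair_on X S i j \<longleftrightarrow>
     (\<exists>m :: nat \<Rightarrow> int. (\<forall>k\<in>S. 0 < m k) \<and> m i < m j \<and>
        (\<forall>k\<in>S. cycle_dot X S m k \<le> - 2 * canon X k))"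

definition NN_on :: "resolution \<Rightarrow> nat set \<Rightarrow> bool" where
  "NN_on X S \<longleftrightarrow> (\<forall>i\<in>S. \<forall>j\<in>S. i \<noteq> j \<longrightarrow> NN_pair_on X S i j)"

definition NN :: "resolution \<Rightarrow> bool" where
  "NN X \<longleftrightarrow> NN_on X (comps X)"

lemma canon_adjunction:
  assumes "minimal_resolution X" "i \<in> comps X"
  shows "canon X i = 2 * (genus X i - 1) - isect X i i"
  using assms by (auto simp: minimal_resolution_def genus_def)

lemma minimal_resolution_self_neg:
  assumes "minimal_resolution X" "i \<in> comps X"
  shows "isect X i i < 0"
proof -
  define x :: "nat \<Rightarrow> real" where "x = (\<lambda>k. if k = i then 1 else 0)"
  have fin: "finite (comps X)" by (simp add: comps_def)
  have "(\<Sum>k\<in>comps X. \<Sum>l\<in>comps X. x k * x l * of_int (isect X k l))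
      = (\<Sum>k\<in>comps X. if k = i then of_int (isect X i i) else 0)"
  proof (rule sum.cong[OF refl])
    fix k
    have "(\<Sum>l\<in>comps X. x k * x l * of_int (isect X k l))
        = (\<Sum>l\<in>comps X. if l = i then x k * of_int (isect X k i) else 0)"
      by (rule sum.cong) (auto simp: x_def)
    then show "(\<Sum>l\<in>comps X. x k * x l * of_int (isect X k l))
        = (if k = i then of_int (isect X i i) else 0)"
      using fin assms(2) by (simp add: x_def)
  qed
  also have "\<dots> = of_int (isect X i i)" using fin assms(2) by simp
  finally have eq: "(\<Sum>k\<in>comps X. \<Sum>l\<in>comps X. x k * x l * of_int (isect X k l))
      = of_int (isect X i i)" .
  have "\<exists>k\<in>comps X. x k \<noteq> 0" using assms(2) by (auto simp: x_def)
  then have "(\<Sum>k\<in>comps X. \<Sum>l\<in>comps X. x k * x l * of_int (isect X k l)) < 0"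
    using assms(1) unfolding minimal_resolution_def by blast
  then show ?thesis using eq by simp
qed

lemma minimal_resolution_canon_nonneg:
  assumes "minimal_resolution X" "i \<in> comps X"
  shows "0 \<le> canon X i"
proof -
  have "0 \<le> genus X i" "\<not> (genus X i = 0 \<and> isect X i i = - 1)"
    using assms unfolding minimal_resolution_def by blast+
  then show ?thesis
    using canon_adjunction[OF assms] minimal_resolution_self_neg[OF assms]
    by (cases "genus X i = 0") auto
qed

end

theory Submission
  imports Defs
begin

text \<open>
  Dropping components from a cycle with positive coefficients can only lower its intersection number
  with each remaining component, so the witnesses for \<open>X\<close> restrict to any full subgraph. If the
  self-intersections drop by \<open>d\<^sub>k \<ge> 0\<close>, adjunction raises \<open>K \<cdot> E\<^sub>k\<close> by \<open>d\<^sub>k\<close>, and twice the old witness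
  works: the left-hand side drops by \<open>2 m\<^sub>k d\<^sub>k \<ge> 2 d\<^sub>k\<close>, and doubling keeps the old
  inequality because \<open>K \<cdot> E\<^sub>k \<ge> 0\<close>.
\<close>

lemma finite_comps [simp]: "finite (comps X)"
  by (simp add: comps_def)

lemma cycle_dot_mono_support:
  assumes "minimal_resolution X" "T \<subseteq> comps X" "S \<subseteq> T" "k \<in> S"
    and "\<And>l. l \<in> T \<Longrightarrow> 0 \<le> m l"
  shows "cycle_dot X S m k \<le> cycle_dot X T m k"
  unfolding cycle_dot_def
proof (rule sum_mono2)
  show "finite T"
    using assms(2) by (rule finite_subset) simp
  fix l assume l: "l \<in> T - S"
  with assms have "l \<in> comps X" "k \<in> comps X" "l \<noteq> k"
    by auto
  with assms(1) have "0 \<le> isect X l k"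
    unfolding minimal_resolution_def by blast
  with l assms(5) show "0 \<le> m l * isect X l k"
    by simp
qed (fact assms(3))

lemma NN_on_subset:
  assumes "minimal_resolution X" "NN_on X T" "T \<subseteq> comps X" "S \<subseteq> T"
  shows "NN_on X S"
  unfolding NN_on_def
proof (intro ballI impI)
  fix i j assume "i \<in> S" "j \<in> S" "i \<noteq> j"
  with assms(2,4) have "NN_pair_on X T i j"
    unfolding NN_on_def by blast
  then obtain m where m: "\<And>k. k \<in> T \<Longrightarrow> 0 < m k" "m i < m j"
      "\<And>k. k \<in> T \<Longrightarrow> cycle_dot X T m k \<le> - 2 * canon X k"
    unfolding NN_pair_on_def by blast
  have "cycle_dot X S m k \<le> - 2 * canon X k" if "k \<in> S" for k
    using cycle_dot_mono_support[OF assms(1,3,4) that, of m] m(1,3) that assms(4)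
    by (meson order.strict_implies_order order_trans subsetD)
  with m(1,2) assms(4) show "NN_pair_on X S i j"
    unfolding NN_pair_on_def by blast
qed

lemma NN_decrease_self_intersections:
  assumes X: "minimal_resolution X" "NN X"
    and X': "minimal_resolution X'" "ncomp X' = ncomp X"
    and genus: "\<And>i. i \<in> comps X \<Longrightarrow> genus X' i = genus X i"
    and isect: "\<And>i j. i \<in> comps X \<Longrightarrow> j \<in> comps X \<Longrightarrow> i \<noteq> j \<Longrightarrow> isect X' i j = isect X i j"
    and self: "\<And>i. i \<in> comps X \<Longrightarrow> isect X' i i \<le> isect X i i"
  shows "NN X'"
proof -
  have comps: "comps X' = comps X"
    using X'(2) by (simp add: comps_def)
  have "NN_pair_on X' (comps X) i j" if "i \<in> comps X" "j \<in> comps X" "i \<noteq> j" for i j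
  proof -
    from X(2) that have "NN_pair_on X (comps X) i j"
      unfolding NN_def NN_on_def by blast
    then obtain m where m: "\<And>k. k \<in> comps X \<Longrightarrow> 0 < m k" "m i < m j"
        "\<And>k. k \<in> comps X \<Longrightarrow> cycle_dot X (comps X) m k \<le> - 2 * canon X k"
      unfolding NN_pair_on_def by blast
    define m' where "m' = (\<lambda>k. 2 * m k)"
    have "cycle_dot X' (comps X) m' k \<le> - 2 * canon X' k" if k: "k \<in> comps X" for k
    proof -
      define d where "d = isect X k k - isect X' k k"
      have "d \<ge> 0"
        using self[OF k] by (simp add: d_def)
      have canon: "canon X' k = canon X k + d"
        using canon_adjunction[OF X(1) k] canon_adjunction[OF X'(1)] k genus[OF k] comps
        by (simp add: d_def)
      have "(\<Sum>l\<in>comps X - {k}. m l * isect X' l k) = (\<Sum>l\<in>comps X - {k}. m l * isect X l k)"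
        using isect k by (intro sum.cong) auto
      then have "cycle_dot X' (comps X) m k = cycle_dot X (comps X) m k - m k * d"
        using k by (simp add: cycle_dot_def sum.remove d_def algebra_simps)
      moreover have "cycle_dot X' (comps X) m' k = 2 * cycle_dot X' (comps X) m k"
        by (simp add: cycle_dot_def m'_def sum_distrib_left mult.assoc)
      moreover have "d \<le> m k * d"
        using m(1)[OF k] \<open>d \<ge> 0\<close> mult_right_mono[of 1 "m k" d] by simp
      ultimately show ?thesis
        using m(3)[OF k] minimal_resolution_canon_nonneg[OF X(1) k] canon by linarith
    qed
    moreover have "\<forall>k\<in>comps X. 0 < m' k" "m' i < m' j"
      using m(1,2) by (simp_all add: m'_def)
    ultimately show ?thesis
      unfolding NN_pair_on_def by blast
  qed
  then show ?thesis
    by (simp add: NN_def NN_on_def comps)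
qed

theorem proposition2:
  fixes X :: resolution
  assumes "minimal_resolution X"
    and "NN X"
  shows "(\<forall>I. I \<subseteq> comps X \<longrightarrow> NN_on X I) \<and>
    (\<forall>X' :: resolution.
       minimal_resolution X' \<and> ncomp X' = ncomp X \<and>
       (\<forall>i\<in>comps X. genus X' i = genus X i) \<and>
       (\<forall>i\<in>comps X. \<forall>j\<in>comps X. i \<noteq> j \<longrightarrow> isect X' i j = isect X i j) \<and>
       (\<forall>i\<in>comps X. isect X' i i \<le> isect X i i)
       \<longrightarrow> NN X')"
proof (intro conjI allI impI)
  fix I assume "I \<subseteq> comps X"
  with assms show "NN_on X I"
    unfolding NN_def by (blast intro: NN_on_subset)
next
  fix X' :: resolution
  assume "minimal_resolution X' \<and> ncomp X' = ncomp X \<and>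
       (\<forall>i\<in>comps X. genus X' i = genus X i) \<and>
       (\<forall>i\<in>comps X. \<forall>j\<in>comps X. i \<noteq> j \<longrightarrow> isect X' i j = isect X i j) \<and>
       (\<forall>i\<in>comps X. isect X' i i \<le> isect X i i)"
  then show "NN X'"
    using NN_decrease_self_intersections[OF assms] by blast
qed

end
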